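(* Let $H\in\mathbb{R}^{n\times n}$ be positive definite, let $f\in\mathbb{R}^n$, let $G(V,E)$ be an undirected graph with $V=\{1,2,\dots,n\}$, let $\{V_k\}_{k\in\mathcal{K}}$, $\mathcal{K}=\{1,2,\dots,K\}$, be a partition of $V$, let $\omega\ge 0$ be an integer, and let $\{V_k^\omega\}_{k\in\mathcal{K}}$ be the associated overlapping regions. Let $\mathcal{T}=\{0,1,2,\dots\}$, let $\mathcal{T}_k\subseteq\mathcal{T}$ for $k\in\mathcal{K}$, and let $\tau_{k,k'}(t)$ be integers with $0\le\tau_{k,k'}(t)\le t$ for $k,k'\in\mathcal{K}$, $t\in\mathcal{T}_k$, such that (a) each set $\mathcal{T}_k$, $k\in\mathcal{K}$, is infinite; (b) $\lim_{t\to\infty}\tau_{k,k'}(t)=\infty$ (limit over $t\in\mathcal{T}_k$) for all $k,k'\in\mathcal{K}$. Consider the asynchronous scheme, started at $x^{(0)}\in\mathbb{R}^n$: for $k\in\mathcal{K}$ and $t\in\mathcal{T}$, $$x_k^{(t+1)}=\begin{cases}S_k^\omega x^{k,(t)}+U_k^\omega f & t\in\mathcal{T}_k\\ x_k^{(t)}&\text{otherwise,}\end{cases}\qquad x^{k,(t)}:=\left(x_1^{(\tau_{k,1}(t))},x_2^{(\tau_{k,2}(t))},\dots,x_K^{(\tau_{k,K}(t))}\right),$$ where $x^{(t)}=(x_1^{(t)},\dots,x_K^{(t)})$ and $x_k^{(t)}\in\mathbb{R}^{|V_k|}$ is the block of $x^{(t)}$ on $V_k$. If $\Vert S^\omega\Vert_\infty<1$,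 then $x^{(t)}$ converges, as $t\to\infty$, to the solution of $Hx=f$.
   Context: Positive definite real matrices are understood to be symmetric. $\Vert\cdot\Vert_\infty$ of a matrix is the induced infinity norm, $\Vert A\Vert_\infty=\max_i\sum_j|(A)_{i,j}|$. $d_G(i,j)$ is the graph distance (smallest number of edges on a path between $i$ and $j$), and $d_G(i,Y):=\min_{y\in Y}d_G(i,y)$ for a vertex set $Y$. Partition and overlap: the nodes are labeled so that the blocks are consecutive, $V_k=\{\sum_{k'=1}^{k-1}|V_{k'}|+1,\dots,\sum_{k'=1}^{k}|V_{k'}|\}$. The overlapping region is $V_k^\omega:=\{i\in V\mid d_G(i,V_k)\le\omega\}$. Matrices: with $e_i$ the standard unit vectors of $\mathbb{R}^n$, let $T_k$, $T_k^\omega$, $T_{-k}^\omega$ be the matrices whose columns are $e_i$ (in increasing order of $i$) for $i\in V_k$, $i\in V_k^\omega$, $i\in V\setminus V_k^\omega$, respectively. Put $H_k^\omega:=(T_k^\omega)^T H T_k^\omega$ and $H_{-k}^\omega:=(T_k^\omega)^T H T_{-k}^\omega$. If $V_k^\omega=V$, then $H^\omega_{-k}$ and $T^\omega_{-k}$ are empty matrices (so $S_k^\omega$ below is $0$). Define $$S_k^\omega:=-(T_k)^T T_k^\omega (H_k^\omega)^{-1}H_{-k}^\omega (T_{-k}^\omega)^T,\qquad U_k^\omega:=(T_k)^T T_k^\omega (H_k^\omega)^{-1}(T_k^\omega)^T,$$ and let $S^\omega\in\mathbb{R}^{n\times n}$ be obtained by stacking vertically $S_1^\omega,\dots,S_K^\omega$.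 Interpretation: $\mathcal{T}_k$ is the set of times at which block $k$ is updated, and $\tau_{k,k'}(t)$ is the (possibly delayed) time index of the information from block $k'$ used to compute $x_k^{(t+1)}$. *)

theory Defs
  imports
    "Jordan_Normal_Form.Gauss_Jordan_Elimination"
    "Graph_Theory.Arc_Walk"
    "HOL-Library.Extended_Nat"
    "HOL-Library.Disjoint_Sets"
begin

definition positive_definite :: "real mat \<Rightarrow> bool" where
  "positive_definite A \<longleftrightarrow>
     square_mat A \<and> A\<^sup>T = A \<and>
     (\<forall>x \<in> carrier_vec (dim_row A). x \<noteq> 0\<^sub>v (dim_row A) \<longrightarrow> x \<bullet> (A *\<^sub>v x) > 0)"

text \<open>For a matrix without rows the value is unspecified.\<close>

definition inf_norm_mat :: "real mat \<Rightarrow> real" where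
  "inf_norm_mat A = Max ((\<lambda>i. \<Sum>j<dim_col A. \<bar>A $$ (i, j)\<bar>) ` {..<dim_row A})"

text \<open>Undirected graphs are symmetric digraphs. The distance is infinite when no path
  joins the two vertices.\<close>

definition graph_dist :: "('a, 'b) pre_digraph \<Rightarrow> 'a \<Rightarrow> 'a \<Rightarrow> enat" where
  "graph_dist G u v = (INF p \<in> {p. pre_digraph.apath G u p v}. enat (length p))"

definition graph_dist_set :: "('a, 'b) pre_digraph \<Rightarrow> 'a \<Rightarrow> 'a set \<Rightarrow> enat" where
  "graph_dist_set G u Y = (INF y \<in> Y. graph_dist G u y)"

definition overlap :: "('a, 'b) pre_digraph \<Rightarrow> nat \<Rightarrow> 'a set \<Rightarrow> 'a set" where
  "overlap G \<omega> A = {i \<in> verts G. graph_dist_set G i A \<le> enat \<omega>}"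

text \<open>Vertices are numbered from 1, whereas vector and matrix entries are indexed from 0:
  vertex \<open>i\<close> corresponds to index \<open>i - 1\<close>.\<close>

definition selection_mat :: "nat \<Rightarrow> nat set \<Rightarrow> real mat" where
  "selection_mat n A = mat_of_cols n (map (\<lambda>i. unit_vec n (i - 1)) (sorted_list_of_set A))"

definition block_vec :: "nat set \<Rightarrow> real vec \<Rightarrow> real vec" where
  "block_vec A x = vec_of_list (map (\<lambda>i. x $ (i - 1)) (sorted_list_of_set A))"

definition concat_vecs :: "real vec list \<Rightarrow> real vec" where
  "concat_vecs vs = foldr (@\<^sub>v) vs (0\<^sub>v 0)"

definition stack_rows :: "nat \<Rightarrow> real mat list \<Rightarrow> real mat" where
  "stack_rows n Ms = foldr (@\<^sub>r) Ms (0\<^sub>m 0 n)"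

text \<open>\<open>the (mat_inverse M)\<close> is the inverse of an invertible \<open>M\<close>; principal submatrices of a
  positive definite matrix are invertible. Below, \<open>A\<close> is a block and \<open>W\<close> its overlapping region.\<close>

definition S_block :: "real mat \<Rightarrow> nat set \<Rightarrow> nat set \<Rightarrow> real mat" where
  "S_block H A W =
     (let n = dim_row H;
          T = selection_mat n A;
          T\<^sub>W = selection_mat n W;
          T\<^sub>C = selection_mat n ({1..n} - W);
          H\<^sub>W = T\<^sub>W\<^sup>T * H * T\<^sub>W;
          H\<^sub>C = T\<^sub>W\<^sup>T * H * T\<^sub>C
      in - (T\<^sup>T * T\<^sub>W * the (mat_inverse H\<^sub>W) * H\<^sub>C * T\<^sub>C\<^sup>T))"

definition U_block :: "real mat \<Rightarrow> nat set \<Rightarrow> nat set \<Rightarrow> real mat" where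
  "U_block H A W =
     (let n = dim_row H;
          T = selection_mat n A;
          T\<^sub>W = selection_mat n W;
          H\<^sub>W = T\<^sub>W\<^sup>T * H * T\<^sub>W
      in T\<^sup>T * T\<^sub>W * the (mat_inverse H\<^sub>W) * T\<^sub>W\<^sup>T)"

definition S_full :: "real mat \<Rightarrow> (nat, 'b) pre_digraph \<Rightarrow> nat \<Rightarrow> nat \<Rightarrow> (nat \<Rightarrow> nat set) \<Rightarrow> real mat" where
  "S_full H G \<omega> K V =
     stack_rows (dim_row H) (map (\<lambda>k. S_block H (V k) (overlap G \<omega> (V k))) [1..<Suc K])"

text \<open>The vector assembled by block \<open>k\<close> at time \<open>t\<close> from the delayed information.\<close>

definition delayed_vec ::
  "nat \<Rightarrow> (nat \<Rightarrow> nat set) \<Rightarrow> (nat \<Rightarrow> nat \<Rightarrow> nat \<Rightarrow> nat) \<Rightarrow> (nat \<Rightarrow> real vec) \<Rightarrow> nat \<Rightarrow> nat \<Rightarrow> real vec" where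
  "delayed_vec K V \<tau> x k t =
     concat_vecs (map (\<lambda>k'. block_vec (V k') (x (\<tau> k k' t))) [1..<Suc K])"

end

theory Submission
  imports Defs "Jordan_Normal_Form.Determinant"
begin

text \<open>
  The solution \<open>y\<close> of \<open>H y = f\<close> is a fixed point of every block update
  (\<open>overlapping_block_equation\<close>): restricting \<open>H y = f\<close> to the rows in an overlapping region
  and solving for the unknowns in that region recovers \<open>y\<close> there, in particular on the block.
  Subtracting this identity from the scheme removes \<open>f\<close>: an update replaces the error on a block by
  the corresponding rows of \<open>S\<^sup>\<omega>\<close> applied to a vector of delayed errors.

  The absolute row sums of \<open>S\<^sup>\<omega>\<close> are bounded by \<open>q = \<parallel>S\<^sup>\<omega>\<parallel>\<^sub>\<infinity> < 1\<close>. Hence, if all delayed errors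
  used in an update have absolute value at most \<open>C\<close>, the updated errors have absolute value at most
  \<open>q C\<close>. The maximum norm makes this bound separate over the components, so it does not matter
  that different components come from different times; \<open>async_contraction_tendsto_zero\<close> turns it
  into convergence of the errors to zero. The fixed point property rests on two facts: an
  overlapping region contains its block (\<open>subset_overlap\<close>), and the principal submatrices of \<open>H\<close> are
  again positive definite, hence invertible (\<open>positive_definite_principal_submatrix\<close>).
\<close>

section \<open>Asynchronous contractions\<close>

text \<open>
  Convergence is by nested boxes. After some time all components stay within \<open>q\<^sup>m B\<close>. Since the delayed
  times tend to infinity, every sufficiently late update uses only data from within this box, so it
  produces a value within \<open>q\<^sup>m\<^sup>+\<^sup>1 B\<close>. Each component is updated at least once more, and later steps either
  update it again or leave it alone, so eventually all components are in the smaller box for good.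
\<close>

lemma async_contraction_tendsto_zero:
  fixes e :: "nat \<Rightarrow> 'i \<Rightarrow> 'b::real_normed_vector" and a :: "'i \<Rightarrow> 'i \<Rightarrow> real"
  assumes fin: "finite I" and q: "q < 1"
    and nonneg: "\<And>i j. i \<in> I \<Longrightarrow> j \<in> I \<Longrightarrow> 0 \<le> a i j"
    and row: "\<And>i. i \<in> I \<Longrightarrow> (\<Sum>j\<in>I. a i j) \<le> q"
    and inf: "\<And>i. i \<in> I \<Longrightarrow> infinite (T i)"
    and past: "\<And>i j t. i \<in> I \<Longrightarrow> j \<in> I \<Longrightarrow> t \<in> T i \<Longrightarrow> \<sigma> i j t \<le> t"
    and lim: "\<And>i j. i \<in> I \<Longrightarrow> j \<in> I \<Longrightarrow> filterlim (\<sigma> i j) at_top (inf at_top (principal (T i)))"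
    and upd: "\<And>i t. i \<in> I \<Longrightarrow> t \<in> T i \<Longrightarrow>
                norm (e (Suc t) i) \<le> (\<Sum>j\<in>I. a i j * norm (e (\<sigma> i j t) j))"
    and hold: "\<And>i t. i \<in> I \<Longrightarrow> t \<notin> T i \<Longrightarrow> e (Suc t) i = e t i"
    and i: "i \<in> I"
  shows "(\<lambda>t. e t i) \<longlonglongrightarrow> 0"
proof -
  \<comment> \<open>updates never increase the maximum over the past, so \<open>B\<close> bounds all later values too\<close>
  define B where "B = Max ((\<lambda>j. norm (e 0 j)) ` I)"
  have B0: "norm (e 0 j) \<le> B" if "j \<in> I" for j
    unfolding B_def using fin that by (intro Max_ge) auto
  have B_nonneg: "0 \<le> B"
    using B0[OF i] norm_ge_zero[of "e 0 i"] by linarith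
  have q0: "0 \<le> q"
    using row[OF i] sum_nonneg[of I "a i"] nonneg[OF i] by force
  have step: "norm (e (Suc t) k) \<le> q * C"
    if k: "k \<in> I" and t: "t \<in> T k" and C: "0 \<le> C"
      and old: "\<And>j. j \<in> I \<Longrightarrow> norm (e (\<sigma> k j t) j) \<le> C" for k t C
  proof -
    have "norm (e (Suc t) k) \<le> (\<Sum>j\<in>I. a k j * C)"
      using upd[OF k t] sum_mono[of I "\<lambda>j. a k j * norm (e (\<sigma> k j t) j)" "\<lambda>j. a k j * C"]
        mult_left_mono[OF old nonneg[OF k]] by (meson order_trans)
    also have "\<dots> \<le> q * C"
      unfolding sum_distrib_right[symmetric] by (rule mult_right_mono[OF row[OF k] C])
    finally show ?thesis .
  qed
  have bounded: "\<forall>k\<in>I. norm (e t k) \<le> B" for t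
  proof (induction t rule: less_induct)
    case (less t)
    show ?case
    proof
      fix k assume k: "k \<in> I"
      show "norm (e t k) \<le> B"
      proof (cases t)
        case 0
        then show ?thesis using B0 k by simp
      next
        case (Suc s)
        have "q * B \<le> B"
          using B_nonneg q by (simp add: mult_left_le_one_le q0)
        moreover have "norm (e (Suc s) k) \<le> q * B" if "s \<in> T k"
          using past[OF k _ that] less Suc by (intro step[OF k that B_nonneg]) (simp add: less_Suc_eq_le)
        ultimately show ?thesis
          using hold[OF k, of s] less k Suc by (cases "s \<in> T k") auto
      qed
    qed
  qed
  have box: "\<exists>s. \<forall>t\<ge>s. \<forall>k\<in>I. norm (e t k) \<le> q ^ m * B" for m
  proof (induction m)
    case 0
    show ?case using bounded by auto
  next
    case (Suc m)
    then obtain s where s: "\<And>t k. t \<ge> s \<Longrightarrow> k \<in> I \<Longrightarrow> norm (e t k) \<le> q ^ m * B"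
      by auto
    have "eventually (\<lambda>t. norm (e t k) \<le> q ^ Suc m * B) sequentially" if k: "k \<in> I" for k
    proof -
      have "eventually (\<lambda>t. t \<in> T k \<longrightarrow> s \<le> \<sigma> k j t) at_top" if "j \<in> I" for j
        using lim[OF k that] by (simp add: filterlim_at_top eventually_inf_principal)
      then have "eventually (\<lambda>t. \<forall>j\<in>I. t \<in> T k \<longrightarrow> s \<le> \<sigma> k j t) at_top"
        by (intro eventually_ball_finite[OF fin] ballI)
      then obtain r where r: "\<And>t j. t \<ge> r \<Longrightarrow> j \<in> I \<Longrightarrow> t \<in> T k \<Longrightarrow> s \<le> \<sigma> k j t"
        by (auto simp: eventually_sequentially)
      have new: "norm (e (Suc t) k) \<le> q ^ Suc m * B" if "t \<ge> r" "t \<in> T k" for t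
        using step[OF k that(2), of "q ^ m * B"] s r[OF that(1) _ that(2)] q0 B_nonneg
        by (simp add: mult.assoc)
      \<comment> \<open>from an update at a time \<open>u \<ge> r\<close> on, component \<open>k\<close> stays in the smaller box\<close>
      obtain u where u: "u \<ge> r" "u \<in> T k"
        using inf[OF k] by (meson infinite_nat_iff_unbounded_le)
      have "norm (e t k) \<le> q ^ Suc m * B" if "t \<ge> Suc u" for t
        using that
      proof (induction t rule: dec_induct)
        case base
        show ?case by (rule new[OF u])
      next
        case (step t)
        then show ?case
          using new[of t] hold[OF k, of t] u by (cases "t \<in> T k") auto
      qed
      then show ?thesis
        by (auto simp: eventually_sequentially)
    qed
    then have "eventually (\<lambda>t. \<forall>k\<in>I. norm (e t k) \<le> q ^ Suc m * B) sequentially"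
      by (intro eventually_ball_finite[OF fin] ballI)
    then show ?case
      by (simp only: eventually_sequentially)
  qed
  show ?thesis
  proof (rule LIMSEQ_I)
    fix r :: real assume r: "0 < r"
    have "(\<lambda>m. q ^ m * B) \<longlonglongrightarrow> 0"
      using tendsto_mult_left_zero[OF LIMSEQ_realpow_zero[OF q0 q], of B] .
    from order_tendstoD(2)[OF this r] obtain m where "q ^ m * B < r"
      by (auto simp: eventually_sequentially)
    then show "\<exists>s. \<forall>t\<ge>s. norm (e t i - 0) < r"
      using box[of m] i by fastforce
  qed
qed

section \<open>Selection matrices\<close>

lemma selection_mat_carrier [simp]: "selection_mat n A \<in> carrier_mat n (card A)"
  by (auto simp: selection_mat_def)

lemma selection_mat_dims [simp]:
  "dim_row (selection_mat n A) = n" "dim_col (selection_mat n A) = card A"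
  using selection_mat_carrier[of n A] by blast+

lemma nth_sorted_list_mem:
  assumes "finite A" "j < card A"
  shows "sorted_list_of_set A ! j \<in> A"
  using assms by (metis length_sorted_list_of_set nth_mem set_sorted_list_of_set)

lemma selection_mat_index:
  assumes "A \<subseteq> {1..n}" "i < n" "j < card A"
  shows "selection_mat n A $$ (i, j) = (if sorted_list_of_set A ! j = Suc i then 1 else 0)"
proof -
  have "finite A" using assms(1) finite_subset by blast
  then have "sorted_list_of_set A ! j \<in> {1..n}"
    using nth_sorted_list_mem assms by blast
  then show ?thesis
    using assms unfolding selection_mat_def
    by (subst mat_of_cols_index) (auto simp: unit_vec_def)
qed

lemma dim_block_vec [simp]: "dim_vec (block_vec A v) = card A"
  by (simp add: block_vec_def)

lemma block_vec_carrier [simp]: "block_vec A v \<in> carrier_vec (card A)"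
  by (simp add: carrier_vecI)

lemma block_vec_index:
  "j < card A \<Longrightarrow> block_vec A v $ j = v $ (sorted_list_of_set A ! j - 1)"
  by (simp add: block_vec_def vec_of_list_index del: vec_of_list_map)

text \<open>
  The transposed selection matrix restricts a vector to a block, and the selection matrix extends a
  block by zero. These two facts let all products with selection matrices be computed as
  restrictions and extensions of vectors.
\<close>

lemma selection_mat_transpose_mult_vec:
  assumes A: "A \<subseteq> {1..n}" and v: "v \<in> carrier_vec n"
  shows "(selection_mat n A)\<^sup>T *\<^sub>v v = block_vec A v"
proof (rule eq_vecI)
  fix j assume "j < dim_vec (block_vec A v)"
  then have j: "j < card A" by simp
  have "finite A" using A finite_subset by blast
  then have mem: "sorted_list_of_set A ! j \<in> {1..n}"
    using nth_sorted_list_mem A j by blast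
  have "((selection_mat n A)\<^sup>T *\<^sub>v v) $ j
      = (\<Sum>i = 0..<n. selection_mat n A $$ (i, j) * v $ i)"
    using j v by (simp add: scalar_prod_def)
  also have "\<dots> = (\<Sum>i = 0..<n. if i = sorted_list_of_set A ! j - 1 then v $ i else 0)"
    using mem by (intro sum.cong) (auto simp: selection_mat_index[OF A _ j])
  also have "\<dots> = block_vec A v $ j"
    using mem j by (auto simp: block_vec_index)
  finally show "((selection_mat n A)\<^sup>T *\<^sub>v v) $ j = block_vec A v $ j" .
qed simp

lemma selection_mat_block_vec:
  assumes A: "A \<subseteq> {1..n}"
  shows "selection_mat n A *\<^sub>v block_vec A v = vec n (\<lambda>i. if Suc i \<in> A then v $ i else 0)"
proof (rule eq_vecI)
  fix i assume "i < dim_vec (vec n (\<lambda>i. if Suc i \<in> A then v $ i else 0))"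
  then have i: "i < n" by simp
  have fin: "finite A" using A finite_subset by blast
  let ?l = "sorted_list_of_set A"
  have "(selection_mat n A *\<^sub>v block_vec A v) $ i
      = (\<Sum>j = 0..<card A. selection_mat n A $$ (i, j) * block_vec A v $ j)"
    using i by (simp add: scalar_prod_def)
  also have "\<dots> = (\<Sum>j = 0..<card A. (if ?l ! j = Suc i then v $ i else 0))"
    using i by (intro sum.cong) (auto simp: selection_mat_index[OF A] block_vec_index)
  also have "\<dots> = (\<Sum>b\<in>A. if b = Suc i then v $ i else 0)"
    using bij_betw_nth[of ?l "{0..<card A}" A] fin
    by (intro sum.reindex_bij_betw) (auto simp: atLeast0LessThan)
  also have "\<dots> = (if Suc i \<in> A then v $ i else 0)"
    using fin by simp
  finally show "(selection_mat n A *\<^sub>v block_vec A v) $ i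
      = vec n (\<lambda>i. if Suc i \<in> A then v $ i else 0) $ i"
    using i by simp
qed simp

lemma selection_mat_complement:
  assumes W: "W \<subseteq> {1..n}" and v: "v \<in> carrier_vec n"
  shows "selection_mat n W *\<^sub>v block_vec W v
       + selection_mat n ({1..n} - W) *\<^sub>v block_vec ({1..n} - W) v = v"
proof -
  have C: "{1..n} - W \<subseteq> {1..n}" by blast
  show ?thesis
    unfolding selection_mat_block_vec[OF W] selection_mat_block_vec[OF C]
    using v by (intro eq_vecI) auto
qed

lemma block_vec_selection_mat_subset:
  assumes A: "A \<subseteq> W" and W: "W \<subseteq> {1..n}"
  shows "block_vec A (selection_mat n W *\<^sub>v block_vec W v) = block_vec A v"
proof (rule eq_vecI)
  fix j assume "j < dim_vec (block_vec A v)"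
  then have j: "j < card A" by simp
  have "finite A" using finite_subset[OF subset_trans[OF A W]] by simp
  then have "sorted_list_of_set A ! j \<in> A" by (rule nth_sorted_list_mem[OF _ j])
  moreover from this have "1 \<le> sorted_list_of_set A ! j" "sorted_list_of_set A ! j \<le> n"
    "sorted_list_of_set A ! j \<in> W"
    using A W by auto
  ultimately show "block_vec A (selection_mat n W *\<^sub>v block_vec W v) $ j = block_vec A v $ j"
    using j by (simp add: selection_mat_block_vec[OF W] block_vec_index)
qed simp

lemma block_vec_selection_mat:
  assumes W: "W \<subseteq> {1..n}" and z: "z \<in> carrier_vec (card W)"
  shows "block_vec W (selection_mat n W *\<^sub>v z) = z"
proof (rule eq_vecI)
  fix j assume "j < dim_vec z"
  then have j: "j < card W" using z by simp
  have fin: "finite W" using W finite_subset by blast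
  let ?l = "sorted_list_of_set W"
  have m: "?l ! j \<in> {1..n}" using nth_sorted_list_mem[OF fin j] W by blast
  then have "block_vec W (selection_mat n W *\<^sub>v z) $ j
      = (\<Sum>i = 0..<card W. selection_mat n W $$ (?l ! j - 1, i) * z $ i)"
    using j z by (auto simp: block_vec_index scalar_prod_def)
  also have "\<dots> = (\<Sum>i = 0..<card W. if i = j then z $ i else 0)"
    using m j fin nth_eq_iff_index_eq[of ?l]
    by (intro sum.cong) (auto simp: selection_mat_index[OF W])
  finally show "block_vec W (selection_mat n W *\<^sub>v z) $ j = z $ j"
    using j by simp
qed (use z in simp)

section \<open>Positive definite matrices\<close>

lemma positive_definite_det_nonzero:
  assumes "A \<in> carrier_mat n n" "positive_definite A"
  shows "det A \<noteq> 0"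
proof
  assume "det A = 0"
  then obtain v where "v \<in> carrier_vec n" "v \<noteq> 0\<^sub>v n" "A *\<^sub>v v = 0\<^sub>v n"
    using det_0_iff_vec_prod_zero_field[OF assms(1)] by blast
  then show False
    using assms unfolding positive_definite_def by force
qed

lemma mat_inverse_of_positive_definite:
  assumes A: "A \<in> carrier_mat n n" and "positive_definite A"
  shows "the (mat_inverse A) \<in> carrier_mat n n"
    and "A * the (mat_inverse A) = 1\<^sub>m n" and "the (mat_inverse A) * A = 1\<^sub>m n"
proof -
  have "mat_inverse A \<noteq> None"
    using mat_inverse(1)[OF A, of "()"]
      det_non_zero_imp_unit[OF A positive_definite_det_nonzero[OF assms], of "()"]
    by blast
  then obtain B where "mat_inverse A = Some B" by blast
  then show "the (mat_inverse A) \<in> carrier_mat n n"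
    "A * the (mat_inverse A) = 1\<^sub>m n" "the (mat_inverse A) * A = 1\<^sub>m n"
    using mat_inverse(2)[OF A] by auto
qed

text \<open>
  The quadratic form of a principal submatrix at \<open>z\<close> is that of \<open>H\<close> at the extension of \<open>z\<close> by zero,
  and extension by zero is injective.
\<close>

lemma positive_definite_principal_submatrix:
  assumes H: "H \<in> carrier_mat n n" and pd: "positive_definite H" and W: "W \<subseteq> {1..n}"
  shows "positive_definite ((selection_mat n W)\<^sup>T * H * selection_mat n W)"
proof -
  let ?S = "selection_mat n W"
  have S: "?S \<in> carrier_mat n (card W)" by simp
  have sym: "H\<^sup>T = H" using pd by (simp add: positive_definite_def)
  have "(?S\<^sup>T * H * ?S)\<^sup>T = ?S\<^sup>T * (?S\<^sup>T * H)\<^sup>T"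
    by (rule transpose_mult[OF _ S]) (use H in auto)
  also have "(?S\<^sup>T * H)\<^sup>T = H * ?S"
    using transpose_mult[of "?S\<^sup>T" "card W" n H n] H sym by simp
  also have "?S\<^sup>T * (H * ?S) = ?S\<^sup>T * H * ?S"
    using H by (intro assoc_mult_mat[symmetric]) auto
  finally have symS: "(?S\<^sup>T * H * ?S)\<^sup>T = ?S\<^sup>T * H * ?S" .
  moreover have "z \<bullet> (?S\<^sup>T * H * ?S *\<^sub>v z) > 0"
    if z: "z \<in> carrier_vec (card W)" and nz: "z \<noteq> 0\<^sub>v (card W)" for z
  proof -
    have Sz: "?S *\<^sub>v z \<in> carrier_vec n" by (rule mult_mat_vec_carrier[OF S z])
    have "?S *\<^sub>v z \<noteq> 0\<^sub>v n"
    proof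
      assume "?S *\<^sub>v z = 0\<^sub>v n"
      then have "z = block_vec W (0\<^sub>v n)"
        using block_vec_selection_mat[OF W z] by simp
      also have "\<dots> = 0\<^sub>v (card W)"
      proof (rule eq_vecI)
        fix j assume "j < dim_vec (0\<^sub>v (card W) :: real vec)"
        then have j: "j < card W" by simp
        have "sorted_list_of_set W ! j \<in> {1..n}"
          using nth_sorted_list_mem[OF finite_subset[OF W] j] W by auto
        then show "block_vec W (0\<^sub>v n) $ j = 0\<^sub>v (card W) $ j"
          using j by (auto simp: block_vec_index)
      qed simp
      finally show False using nz by simp
    qed
    then have "0 < (?S *\<^sub>v z) \<bullet> (H *\<^sub>v (?S *\<^sub>v z))"
      using pd H Sz unfolding positive_definite_def by auto
    also have "\<dots> = z \<bullet> (?S\<^sup>T *\<^sub>v (H *\<^sub>v (?S *\<^sub>v z)))"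
      using transpose_vec_mult_scalar[of "?S\<^sup>T" "card W" n "H *\<^sub>v (?S *\<^sub>v z)" z] H z S Sz
      by simp
    also have "?S\<^sup>T *\<^sub>v (H *\<^sub>v (?S *\<^sub>v z)) = ?S\<^sup>T * H * ?S *\<^sub>v z"
    proof -
      have 1: "?S\<^sup>T * H \<in> carrier_mat (card W) n" by (rule mult_carrier_mat[OF _ H]) simp
      show ?thesis
        using assoc_mult_mat_vec[OF 1 S z] assoc_mult_mat_vec[OF transpose_carrier_mat[THEN iffD2, OF S] H Sz]
        by simp
    qed
    finally show ?thesis .
  qed
  ultimately show ?thesis
    unfolding positive_definite_def using symS by simp
qed


section \<open>The block iteration fixes the solution\<close>

lemma S_block_carrier:
  assumes H: "H \<in> carrier_mat n n"
  shows "S_block H A W \<in> carrier_mat (card A) n"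
  using H by (auto simp: S_block_def Let_def)

text \<open>
  With \<open>a\<close> and \<open>c\<close> the restrictions of \<open>y\<close> to \<open>W\<close> and to its complement, the rows of \<open>H y\<close> in \<open>W\<close> are
  \<open>H\<^sub>W a + H\<^sub>C c\<close>. Applying \<open>H\<^sub>W\<^sup>-\<^sup>1\<close> and restricting to \<open>A\<close> gives \<open>y\<close> on \<open>A\<close>, because \<open>A \<subseteq> W\<close>, plus a
  term in \<open>c\<close>, which is exactly what the \<open>S\<close>-part subtracts.
\<close>

lemma overlapping_block_equation:
  assumes H: "H \<in> carrier_mat n n" and pd: "positive_definite H"
    and A: "A \<subseteq> W" and W: "W \<subseteq> {1..n}" and y: "y \<in> carrier_vec n"
  shows "block_vec A y = S_block H A W *\<^sub>v y + U_block H A W *\<^sub>v (H *\<^sub>v y)"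
proof -
  let ?C = "{1..n} - W"
  have C: "?C \<subseteq> {1..n}" by blast
  define Q where "Q = selection_mat n A"
  define R where "R = selection_mat n W"
  define N where "N = selection_mat n ?C"
  define HW where "HW = R\<^sup>T * H * R"
  define HC where "HC = R\<^sup>T * H * N"
  define M where "M = the (mat_inverse HW)"
  define P where "P = Q\<^sup>T * R * M"
  define a where "a = block_vec W y"
  define c where "c = block_vec ?C y"
  have Q: "Q \<in> carrier_mat n (card A)" and R: "R \<in> carrier_mat n (card W)"
    and N: "N \<in> carrier_mat n (card ?C)"
    by (simp_all add: Q_def R_def N_def del: card_Diff_subset)
  have QT: "Q\<^sup>T \<in> carrier_mat (card A) n" and RT: "R\<^sup>T \<in> carrier_mat (card W) n"
    and NT: "N\<^sup>T \<in> carrier_mat (card ?C) n"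
    using Q R N by simp_all
  have a: "a \<in> carrier_vec (card W)" and c: "c \<in> carrier_vec (card ?C)"
    by (simp_all add: a_def c_def del: card_Diff_subset)
  have RTH: "R\<^sup>T * H \<in> carrier_mat (card W) n" by (rule mult_carrier_mat[OF RT H])
  have HW: "HW \<in> carrier_mat (card W) (card W)"
    unfolding HW_def by (rule mult_carrier_mat[OF RTH R])
  have HC: "HC \<in> carrier_mat (card W) (card ?C)"
    unfolding HC_def by (rule mult_carrier_mat[OF RTH N])
  have "positive_definite HW"
    unfolding HW_def R_def by (rule positive_definite_principal_submatrix[OF H pd W])
  note inv = mat_inverse_of_positive_definite[OF HW this, folded M_def]
  have QR: "Q\<^sup>T * R \<in> carrier_mat (card A) (card W)" by (rule mult_carrier_mat[OF QT R])
  have P: "P \<in> carrier_mat (card A) (card W)"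
    unfolding P_def by (rule mult_carrier_mat[OF QR inv(1)])
  have Ra: "R *\<^sub>v a \<in> carrier_vec n" and Nc: "N *\<^sub>v c \<in> carrier_vec n"
    by (rule mult_mat_vec_carrier[OF R a] mult_mat_vec_carrier[OF N c])+
  have HWa: "HW *\<^sub>v a \<in> carrier_vec (card W)" and HCc: "HC *\<^sub>v c \<in> carrier_vec (card W)"
    by (rule mult_mat_vec_carrier[OF HW a] mult_mat_vec_carrier[OF HC c])+

  have "S_block H A W *\<^sub>v y = - (P * HC * N\<^sup>T) *\<^sub>v y"
    using H by (simp add: S_block_def Let_def P_def M_def HW_def HC_def Q_def R_def N_def)
  also have "\<dots> = - (P * HC * N\<^sup>T *\<^sub>v y)"
    using y N by (intro uminus_mult_mat_vec) simp
  also have "P * HC * N\<^sup>T *\<^sub>v y = P * HC *\<^sub>v (N\<^sup>T *\<^sub>v y)"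
    by (rule assoc_mult_mat_vec[OF mult_carrier_mat[OF P HC] NT y])
  also have "N\<^sup>T *\<^sub>v y = c"
    unfolding N_def c_def by (rule selection_mat_transpose_mult_vec[OF C y])
  also have "P * HC *\<^sub>v c = P *\<^sub>v (HC *\<^sub>v c)"
    by (rule assoc_mult_mat_vec[OF P HC c])
  finally have S: "S_block H A W *\<^sub>v y = - (P *\<^sub>v (HC *\<^sub>v c))" .

  have "H *\<^sub>v y = H *\<^sub>v (R *\<^sub>v a + N *\<^sub>v c)"
    using selection_mat_complement[OF W y] by (simp add: R_def N_def a_def c_def)
  then have "R\<^sup>T *\<^sub>v (H *\<^sub>v y) = R\<^sup>T *\<^sub>v (H *\<^sub>v (R *\<^sub>v a + N *\<^sub>v c))" by simp
  also have "\<dots> = R\<^sup>T * H *\<^sub>v (R *\<^sub>v a + N *\<^sub>v c)"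
    by (rule assoc_mult_mat_vec[OF RT H add_carrier_vec[OF Ra Nc], symmetric])
  also have "\<dots> = R\<^sup>T * H *\<^sub>v (R *\<^sub>v a) + R\<^sup>T * H *\<^sub>v (N *\<^sub>v c)"
    by (rule mult_add_distrib_mat_vec[OF RTH Ra Nc])
  also have "\<dots> = HW *\<^sub>v a + HC *\<^sub>v c"
    unfolding HW_def HC_def assoc_mult_mat_vec[OF RTH R a] assoc_mult_mat_vec[OF RTH N c] ..
  finally have RHy: "R\<^sup>T *\<^sub>v (H *\<^sub>v y) = HW *\<^sub>v a + HC *\<^sub>v c" .

  have "U_block H A W *\<^sub>v (H *\<^sub>v y) = P * R\<^sup>T *\<^sub>v (H *\<^sub>v y)"
    using H by (simp add: U_block_def Let_def P_def M_def HW_def Q_def R_def)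
  also have "\<dots> = P *\<^sub>v (HW *\<^sub>v a + HC *\<^sub>v c)"
    using assoc_mult_mat_vec[OF P RT mult_mat_vec_carrier[OF H y]] RHy by simp
  also have "\<dots> = P *\<^sub>v (HW *\<^sub>v a) + P *\<^sub>v (HC *\<^sub>v c)"
    by (rule mult_add_distrib_mat_vec[OF P HWa HCc])
  also have "P *\<^sub>v (HW *\<^sub>v a) = Q\<^sup>T * R *\<^sub>v (M *\<^sub>v (HW *\<^sub>v a))"
    unfolding P_def by (rule assoc_mult_mat_vec[OF QR inv(1) HWa])
  also have "M *\<^sub>v (HW *\<^sub>v a) = a"
    using assoc_mult_mat_vec[OF inv(1) HW a] inv(3) a by simp
  also have "Q\<^sup>T * R *\<^sub>v a = Q\<^sup>T *\<^sub>v (R *\<^sub>v a)"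
    by (rule assoc_mult_mat_vec[OF QT R a])
  also have "\<dots> = block_vec A (R *\<^sub>v a)"
    unfolding Q_def by (rule selection_mat_transpose_mult_vec[OF subset_trans[OF A W] Ra])
  also have "\<dots> = block_vec A y"
    unfolding R_def a_def by (rule block_vec_selection_mat_subset[OF A W])
  finally have U: "U_block H A W *\<^sub>v (H *\<^sub>v y) = block_vec A y + P *\<^sub>v (HC *\<^sub>v c)" .
  show ?thesis
    unfolding S U using P
    by (intro eq_vecI) auto
qed

text \<open>The empty walk is a path of length zero from a vertex to itself.\<close>

lemma subset_overlap: "A \<subseteq> verts G \<Longrightarrow> A \<subseteq> overlap G \<omega> A"
proof
  fix i assume A: "A \<subseteq> verts G" and i: "i \<in> A"
  then have "pre_digraph.apath G i [] i"
    by (auto simp: pre_digraph.apath_def pre_digraph.awalk_def pre_digraph.cas.simps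
        pre_digraph.awalk_verts.simps)
  then have "graph_dist G i i \<le> enat 0"
    unfolding graph_dist_def by (intro INF_lower2[of "[]"]) auto
  then have "graph_dist_set G i A \<le> enat 0"
    unfolding graph_dist_set_def using i by (intro INF_lower2[of i]) auto
  also have "\<dots> \<le> enat \<omega>" by simp
  finally show "i \<in> overlap G \<omega> A"
    using A i by (auto simp: overlap_def)
qed

section \<open>Stacking and concatenation\<close>

lemma dim_col_stack_rows:
  "\<forall>M\<in>set Ms. dim_col M = m \<Longrightarrow> dim_col (stack_rows m Ms) = m"
  by (induction Ms) (auto simp: stack_rows_def append_rows_def)

text \<open>
  The position of a row in the stack is irrelevant to row sums, so the statement leaves it
  existential.
\<close>

lemma stack_rows_contains_row:
  assumes "\<forall>M\<in>set Ms. dim_col M = m" "M \<in> set Ms" "l < dim_row M"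
  shows "\<exists>i < dim_row (stack_rows m Ms). \<forall>j<m. stack_rows m Ms $$ (i, j) = M $$ (l, j)"
  using assms
proof (induction Ms)
  case (Cons N Ms)
  have eq: "stack_rows m (N # Ms) = N @\<^sub>r stack_rows m Ms"
    by (simp add: stack_rows_def)
  have dims: "dim_col N = m" "dim_col (stack_rows m Ms) = m"
    using Cons.prems(1) by (auto intro: dim_col_stack_rows)
  show ?case
  proof (cases "M = N")
    case True
    then show ?thesis
      using dims Cons.prems(3) by (intro exI[of _ l]) (auto simp: eq append_rows_def)
  next
    case False
    then obtain i where "i < dim_row (stack_rows m Ms)"
      "\<forall>j<m. stack_rows m Ms $$ (i, j) = M $$ (l, j)"
      using Cons by auto
    then show ?thesis
      using dims by (intro exI[of _ "dim_row N + i"]) (auto simp: eq append_rows_def)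
  qed
qed simp

lemma row_sum_le_inf_norm_mat:
  "i < dim_row A \<Longrightarrow> (\<Sum>j<dim_col A. \<bar>A $$ (i, j)\<bar>) \<le> inf_norm_mat A"
  unfolding inf_norm_mat_def by (rule Max_ge) auto

lemma block_row_sum_le_inf_norm_mat_stack_rows:
  assumes "\<forall>M\<in>set Ms. dim_col M = m" "M \<in> set Ms" "l < dim_row M"
  shows "(\<Sum>j<m. \<bar>M $$ (l, j)\<bar>) \<le> inf_norm_mat (stack_rows m Ms)"
proof -
  obtain i where "i < dim_row (stack_rows m Ms)"
    "\<forall>j<m. stack_rows m Ms $$ (i, j) = M $$ (l, j)"
    using stack_rows_contains_row[OF assms] by blast
  then show ?thesis
    using row_sum_le_inf_norm_mat[of i "stack_rows m Ms"] dim_col_stack_rows[OF assms(1)] by simp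
qed

lemma concat_vecs_snoc: "concat_vecs (vs @ [v]) = concat_vecs vs @\<^sub>v v"
proof (induction vs)
  case (Cons u vs)
  then show ?case
    by (intro eq_vecI) (auto simp: concat_vecs_def)
qed (auto simp: concat_vecs_def intro!: eq_vecI)

lemma dim_concat_vecs_upt:
  "dim_vec (concat_vecs (map g [1..<Suc K])) = (\<Sum>k=1..K. dim_vec (g k))"
proof (induction K)
  case (Suc K)
  have "[1..<Suc (Suc K)] = [1..<Suc K] @ [Suc K]" by simp
  then show ?case
    using Suc by (simp only: map_append list.map concat_vecs_snoc index_append_vec(2)) simp
qed (simp add: concat_vecs_def)

lemma concat_vecs_upt_index:
  assumes "k \<in> {1..K}" "l < dim_vec (g k)"
  shows "concat_vecs (map g [1..<Suc K]) $ ((\<Sum>k'=1..<k. dim_vec (g k')) + l) = g k $ l"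
  using assms
proof (induction K)
  case (Suc K)
  let ?o = "\<lambda>k. \<Sum>k'=1..<k. dim_vec (g k')"
  have "[1..<Suc (Suc K)] = [1..<Suc K] @ [Suc K]" by simp
  then have eq: "concat_vecs (map g [1..<Suc (Suc K)]) = concat_vecs (map g [1..<Suc K]) @\<^sub>v g (Suc K)"
    by (simp only: map_append list.map concat_vecs_snoc)
  have dim: "dim_vec (concat_vecs (map g [1..<Suc K])) = ?o (Suc K)"
    by (simp only: dim_concat_vecs_upt atLeastLessThanSuc_atLeastAtMost)
  show ?case
  proof (cases "k = Suc K")
    case True
    then show ?thesis
      using Suc.prems(2) unfolding eq by (subst index_append_vec) (simp_all only: dim, simp_all)
  next
    case False
    then have k: "k \<in> {1..K}" using Suc.prems(1) by auto
    then have "?o (Suc k) \<le> ?o (Suc K)"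
      by (intro sum_mono2) auto
    then have "?o k + l < ?o (Suc K)"
      using Suc.prems(2) k by simp
    then show ?thesis
      using Suc.IH[OF k Suc.prems(2)] unfolding eq
      by (subst index_append_vec) (simp_all only: dim, simp_all)
  qed
qed simp


lemma block_vec_interval_index:
  assumes "A = {b + 1..b + card A}" "l < card A"
  shows "block_vec A v $ l = v $ (b + l)"
proof -
  have "sorted_list_of_set A = [b + 1..<Suc (b + card A)]"
    by (metis assms(1) atLeastLessThanSuc_atLeastAtMost sorted_list_of_set_range)
  then show ?thesis
    using assms(2) by (simp add: block_vec_index del: upt_Suc)
qed

text \<open>
  Because the blocks are consecutive, concatenating them leaves every component at its own index:
  component \<open>i\<close> of the delayed vector is component \<open>i\<close> of an earlier iterate.
\<close>

lemma delayed_vec_index: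
  assumes V: "\<And>k. k \<in> {1..K} \<Longrightarrow>
      V k = {(\<Sum>k'=1..<k. card (V k')) + 1 .. (\<Sum>k'=1..k. card (V k'))}"
    and k': "k' \<in> {1..K}" and i: "Suc i \<in> V k'"
  shows "delayed_vec K V \<tau> x k t $ i = x (\<tau> k k' t) $ i"
proof -
  let ?b = "\<Sum>m=1..<k'. card (V m)"
  have "(\<Sum>m=1..k'. card (V m)) = ?b + card (V k')"
    using k' by (metis atLeastAtMost_iff atLeastLessThanSuc_atLeastAtMost sum.atLeastLessThan_Suc)
  then have Vk': "V k' = {?b + 1..?b + card (V k')}"
    using V[OF k'] by simp
  then have "Suc i \<in> {?b + 1..?b + card (V k')}" using i by blast
  then obtain l where l: "i = ?b + l" "l < card (V k')"
    by (auto simp: le_iff_add)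
  have "delayed_vec K V \<tau> x k t $ i = block_vec (V k') (x (\<tau> k k' t)) $ l"
    unfolding delayed_vec_def l(1)
    using concat_vecs_upt_index[OF k', of l "\<lambda>k'. block_vec (V k') (x (\<tau> k k' t))"] l(2) by simp
  also have "\<dots> = x (\<tau> k k' t) $ i"
    using block_vec_interval_index[OF Vk' l(2)] l(1) by simp
  finally show ?thesis .
qed

theorem theorem3:
  fixes H :: "real mat" and f :: "real vec" and n K \<omega> :: nat
    and G :: "(nat, 'b) pre_digraph"
    and V :: "nat \<Rightarrow> nat set"
    and T :: "nat \<Rightarrow> nat set"
    and \<tau> :: "nat \<Rightarrow> nat \<Rightarrow> nat \<Rightarrow> nat"
    and x :: "nat \<Rightarrow> real vec"
  assumes "H \<in> carrier_mat n n" and "positive_definite H"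
    and "f \<in> carrier_vec n"
    and "pseudo_graph G" and "verts G = {1..n}"
    and "partition_on {1..n} (V ` {1..K})" and "inj_on V {1..K}"
    and "\<And>k. k \<in> {1..K} \<Longrightarrow>
           V k = {(\<Sum>k'=1..<k. card (V k')) + 1 .. (\<Sum>k'=1..k. card (V k'))}"
    and "\<And>k k' t. k \<in> {1..K} \<Longrightarrow> k' \<in> {1..K} \<Longrightarrow> t \<in> T k \<Longrightarrow> \<tau> k k' t \<le> t"
    and "\<And>k. k \<in> {1..K} \<Longrightarrow> infinite (T k)"
    and "\<And>k k'. k \<in> {1..K} \<Longrightarrow> k' \<in> {1..K} \<Longrightarrow>
           filterlim (\<tau> k k') at_top (inf at_top (principal (T k)))"
    and "\<And>t. x t \<in> carrier_vec n"
    and "\<And>k t. k \<in> {1..K} \<Longrightarrow>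
           block_vec (V k) (x (t + 1)) =
             (if t \<in> T k
              then S_block H (V k) (overlap G \<omega> (V k)) *\<^sub>v delayed_vec K V \<tau> x k t
                   + U_block H (V k) (overlap G \<omega> (V k)) *\<^sub>v f
              else block_vec (V k) (x t))"
    and "inf_norm_mat (S_full H G \<omega> K V) < 1"
  shows "\<exists>x_star \<in> carrier_vec n.
           H *\<^sub>v x_star = f
           \<and> (\<forall>y \<in> carrier_vec n. H *\<^sub>v y = f \<longrightarrow> y = x_star)
           \<and> (\<forall>i<n. (\<lambda>t. x t $ i) \<longlonglongrightarrow> x_star $ i)"
proof -
  note H = assms(1) and pd = assms(2) and f = assms(3) and verts = assms(5) and part = assms(6)
    and inj = assms(7) and V = assms(8) and past = assms(9) and inf = assms(10) and lim = assms(11)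
    and x = assms(12) and scheme = assms(13) and norm = assms(14)
  define W where "W k = overlap G \<omega> (V k)" for k
  define S where "S k = S_block H (V k) (W k)" for k
  define y where "y = the (mat_inverse H) *\<^sub>v f"
  note inv = mat_inverse_of_positive_definite[OF H pd]
  have y: "y \<in> carrier_vec n"
    unfolding y_def by (rule mult_mat_vec_carrier[OF inv(1) f])
  have Hy: "H *\<^sub>v y = f"
    unfolding y_def using assoc_mult_mat_vec[OF H inv(1) f] inv(2) f by simp
  have unique: "z = y" if z: "z \<in> carrier_vec n" and "H *\<^sub>v z = f" for z
    using assoc_mult_mat_vec[OF inv(1) H z] inv(3) that by (simp add: y_def)

  have V_sub: "V k \<subseteq> {1..n}" if "k \<in> {1..K}" for k
    using part that unfolding partition_on_def by blast
  have finV: "finite (V k)" if "k \<in> {1..K}" for k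
    using V_sub[OF that] finite_subset by fastforce
  have W_sub: "W k \<subseteq> {1..n}" for k
    unfolding W_def overlap_def verts by blast
  have V_W: "V k \<subseteq> W k" if "k \<in> {1..K}" for k
    unfolding W_def using V_sub[OF that] verts by (intro subset_overlap) simp
  have S_carrier: "S k \<in> carrier_mat (card (V k)) n" for k
    unfolding S_def by (rule S_block_carrier[OF H])

  \<comment> \<open>component \<open>i\<close> of a vector is entry \<open>loc i\<close> of its block \<open>blk i\<close>\<close>
  have "\<exists>k\<in>{1..K}. Suc i \<in> V k" if "i < n" for i
    using that part unfolding partition_on_def by force
  then obtain blk where blk: "\<And>i. i < n \<Longrightarrow> blk i \<in> {1..K}"
    and blk_mem: "\<And>i. i < n \<Longrightarrow> Suc i \<in> V (blk i)"
    by metis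
  have "\<exists>l<card (V (blk i)). sorted_list_of_set (V (blk i)) ! l = Suc i" if "i < n" for i
    using blk_mem[OF that] finV[OF blk[OF that]]
    by (metis in_set_conv_nth length_sorted_list_of_set set_sorted_list_of_set)
  then obtain loc where loc: "\<And>i. i < n \<Longrightarrow> loc i < card (V (blk i))"
    and "\<And>i. i < n \<Longrightarrow> sorted_list_of_set (V (blk i)) ! loc i = Suc i"
    by metis
  then have block: "block_vec (V (blk i)) v $ loc i = v $ i" if "i < n" for i and v :: "real vec"
    using that by (simp add: block_vec_index)

  have "(\<Sum>k=1..K. card (V k)) = card (\<Union> (V ` {1..K}))"
  proof (subst card_UN_disjoint)
    show "\<forall>i\<in>{1..K}. \<forall>j\<in>{1..K}. i \<noteq> j \<longrightarrow> V i \<inter> V j = {}"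
      using part inj unfolding partition_on_def disjoint_def inj_on_def by (metis image_eqI)
  qed (use finV in auto)
  then have dim_delayed: "dim_vec (delayed_vec K V \<tau> x k t) = n" for k t
    using part unfolding delayed_vec_def partition_on_def by (simp only: dim_concat_vecs_upt) simp

  define a where "a i j = \<bar>S (blk i) $$ (loc i, j)\<bar>" for i j
  define q where "q = inf_norm_mat (S_full H G \<omega> K V)"
  have conv: "(\<lambda>t. x t $ i - y $ i) \<longlonglongrightarrow> 0" if i: "i < n" for i
  proof (rule async_contraction_tendsto_zero[where I = "{..<n}" and a = a and q = q
        and T = "\<lambda>i. T (blk i)" and \<sigma> = "\<lambda>i j. \<tau> (blk i) (blk j)"])
    show "(\<Sum>j\<in>{..<n}. a i j) \<le> q" if "i \<in> {..<n}" for i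
    proof -
      have "i < n" using that by simp
      have "S (blk i) \<in> set (map (\<lambda>k. S_block H (V k) (overlap G \<omega> (V k))) [1..<Suc K])"
        using blk[OF \<open>i < n\<close>] unfolding S_def W_def set_map set_upt by (intro imageI) auto
      moreover have "\<forall>M\<in>set (map (\<lambda>k. S_block H (V k) (overlap G \<omega> (V k))) [1..<Suc K]).
          dim_col M = n"
        using S_carrier unfolding S_def W_def by auto
      moreover have "loc i < dim_row (S (blk i))"
        using S_carrier[of "blk i"] loc[OF \<open>i < n\<close>] by simp
      ultimately show ?thesis
        unfolding a_def q_def S_full_def carrier_matD(1)[OF H]
        by (intro block_row_sum_le_inf_norm_mat_stack_rows)
    qed
    show "norm (x (Suc t) $ i - y $ i)
        \<le> (\<Sum>j\<in>{..<n}. a i j * norm (x (\<tau> (blk i) (blk j) t) $ j - y $ j))"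
      if "i \<in> {..<n}" and t: "t \<in> T (blk i)" for i t
    proof -
      have i: "i < n" using that by simp
      let ?k = "blk i"
      let ?d = "delayed_vec K V \<tau> x ?k t"
      let ?U = "U_block H (V ?k) (W ?k) *\<^sub>v f"
      have new: "block_vec (V ?k) (x (Suc t)) = S ?k *\<^sub>v ?d + ?U"
        using scheme[OF blk[OF i], of t] t by (simp add: S_def W_def)
      have fixed: "block_vec (V ?k) y = S ?k *\<^sub>v y + ?U"
        using overlapping_block_equation[OF H pd V_W[OF blk[OF i]] W_sub y] Hy by (simp add: S_def)
      have dimU: "dim_vec ?U = card (V ?k)"
        by (metis fixed dim_block_vec index_add_vec(2))
      have row: "(S ?k *\<^sub>v v) $ loc i = (\<Sum>j<n. S ?k $$ (loc i, j) * v $ j)"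
        if "dim_vec v = n" for v
        using that S_carrier[of ?k] loc[OF i] by (simp add: scalar_prod_def atLeast0LessThan)
      have "x (Suc t) $ i - y $ i = (S ?k *\<^sub>v ?d) $ loc i - (S ?k *\<^sub>v y) $ loc i"
        using block[OF i, of "x (Suc t)"] block[OF i, of y] loc[OF i] dimU
        by (simp add: new fixed)
      also have "\<dots> = (\<Sum>j<n. S ?k $$ (loc i, j) * (?d $ j - y $ j))"
        using y by (simp add: row dim_delayed sum_subtractf right_diff_distrib)
      also have "\<dots> = (\<Sum>j<n. S ?k $$ (loc i, j) * (x (\<tau> ?k (blk j) t) $ j - y $ j))"
        using delayed_vec_index[OF V blk blk_mem] by (intro sum.cong) auto
      also have "norm \<dots> \<le> (\<Sum>j<n. norm (S ?k $$ (loc i, j) * (x (\<tau> ?k (blk j) t) $ j - y $ j)))"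
        by (rule norm_sum)
      finally show ?thesis
        by (simp add: a_def abs_mult)
    qed
    show "x (Suc t) $ i - y $ i = x t $ i - y $ i" if "i \<in> {..<n}" and "t \<notin> T (blk i)" for i t
    proof -
      have "i < n" using that by simp
      then show ?thesis
        using scheme[OF blk, of i t] that(2) block[of i "x (Suc t)"] block[of i "x t"] by simp
    qed
    show "filterlim (\<tau> (blk i) (blk j)) at_top (inf at_top (principal (T (blk i))))"
      if "i \<in> {..<n}" "j \<in> {..<n}" for i j
      using lim blk that by simp
  qed (use norm inf past blk i in \<open>auto simp: a_def q_def\<close>)
  show ?thesis
  proof (intro bexI[of _ y] conjI ballI impI allI)
    show "(\<lambda>t. x t $ i) \<longlonglongrightarrow> y $ i" if "i < n" for i
      using conv[OF that] by (simp add: LIM_zero_iff)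
  qed (fact Hy y unique)+
qed

end
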